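(* Let $L$ be a Finslerian metric on a smooth manifold $M$ and let $\tilde L=(\Phi\circ\pi)L$ be a Jacobi metric of $L$, where $\Phi=e-\phi$ for a smooth function $\phi:M\to\mathbb R$ and a constant $e\in\mathbb R$ with $\Phi>0$ on $M$. If there exists a proper (smooth) function $f:M\to\mathbb R$ such that $g^L_v(\nabla^vf,\nabla^vf)\le\Phi(\pi(v))$ for each $v\in TM\setminus0$, then $\tilde L$ is complete.
   Context: $\pi:TM\to M$ is the projection. A Finslerian metric on $M$ is a smooth function $L:TM\setminus0\to\mathbb R$ with $L(\lambda v)=\lambda^2L(v)$ for $\lambda>0$ such that the fundamental tensor $g^L_v(u,w)=\tfrac12\frac{\partial^2}{\partial t\partial s}\big|_{t=s=0}L(v+tu+sw)$, $u,w\in T_{\pi(v)}M$, is positive definite for every $v\in TM\setminus0$; $L=F^2$ with $F$ the associated positively $1$-homogeneous Finsler norm. For smooth $f:M\to\mathbb R$, the anisotropic $L$-gradient is defined for each $v\in TM\setminus 0$ by $g^L_v(\nabla^vf,w)=df_{\pi(v)}(w)$ for all $w\in T_{\pi(v)}M$. A function $f:M\to\mathbb R$ is proper if preimages of compact sets are compact. A Finslerian metric is complete if it is both forward and backward complete, i.e. every forward Cauchy sequence and every backward Cauchy sequence for its (possibly asymmetric) distance converges. *)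

theory Defs
  imports "HOL-Analysis.Analysis"
begin

section \<open>Smooth maps between normed spaces\<close>

text \<open>
  \<open>C_k_on k f S\<close>, for open \<open>S\<close>: all iterated directional derivatives of order at most \<open>k\<close>
  exist (as Frechet derivatives) and are continuous on \<open>S\<close>.
\<close>

primrec C_k_on :: "nat \<Rightarrow> ('a::real_normed_vector \<Rightarrow> 'b::real_normed_vector) \<Rightarrow> 'a set \<Rightarrow> bool" where
  "C_k_on 0 f S \<longleftrightarrow> continuous_on S f"
| "C_k_on (Suc k) f S \<longleftrightarrow>
     (\<forall>x\<in>S. f differentiable (at x)) \<and>
     (\<forall>v. C_k_on k (\<lambda>x. frechet_derivative f (at x) v) S)"

definition smooth_on :: "'a::real_normed_vector set \<Rightarrow> ('a \<Rightarrow> 'b::real_normed_vector) \<Rightarrow> bool" where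
  "smooth_on S f \<longleftrightarrow> (\<forall>k. C_k_on k f S)"


section \<open>Smooth manifolds\<close>

text \<open>
  The manifold is the whole (Hausdorff, second countable) type \<open>'m\<close>, equipped with a smooth
  atlas \<open>A\<close>, not necessarily maximal. A chart is a pair of its domain and its coordinate map; the
  coordinate map is relevant on the domain only. The dimension of the manifold is \<open>DIM('a)\<close>.
\<close>

type_synonym ('m, 'a) chart = "'m set \<times> ('m \<Rightarrow> 'a)"

definition chart_inv :: "('m, 'a) chart \<Rightarrow> 'a \<Rightarrow> 'm" where
  "chart_inv c = inv_into (fst c) (snd c)"

definition is_chart :: "('m::topological_space, 'a::euclidean_space) chart \<Rightarrow> bool" where
  "is_chart c \<longleftrightarrow> open (fst c) \<and> open (snd c ` fst c) \<and>
     homeomorphism (fst c) (snd c ` fst c) (snd c) (chart_inv c)"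

definition smooth_atlas ::
    "('m::{t2_space,second_countable_topology}, 'a::euclidean_space) chart set \<Rightarrow> bool" where
  "smooth_atlas A \<longleftrightarrow>
     (\<forall>c\<in>A. is_chart c) \<and> (\<Union>c\<in>A. fst c) = UNIV \<and>
     (\<forall>c\<in>A. \<forall>d\<in>A. smooth_on (snd c ` (fst c \<inter> fst d)) (snd d \<circ> chart_inv c))"

definition smooth_function ::
    "('m, 'a::euclidean_space) chart set \<Rightarrow> ('m \<Rightarrow> real) \<Rightarrow> bool" where
  "smooth_function A f \<longleftrightarrow> (\<forall>c\<in>A. smooth_on (snd c ` fst c) (f \<circ> chart_inv c))"


section \<open>The tangent bundle\<close>

text \<open>
  A tangent vector at \<open>p\<close> is the family of its coordinate representations in the charts around
  \<open>p\<close>, which transform by the derivatives of the transition maps. To make the family unique, its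
  entries at all other indices are \<open>0\<close>. The vector space operations are pointwise.
\<close>

type_synonym ('m, 'a) tvec = "('m, 'a) chart \<Rightarrow> 'a"

definition charts_at :: "('m, 'a) chart set \<Rightarrow> 'm \<Rightarrow> ('m, 'a) chart set" where
  "charts_at A p = {c \<in> A. p \<in> fst c}"

definition tangent_space ::
    "('m, 'a::euclidean_space) chart set \<Rightarrow> 'm \<Rightarrow> ('m, 'a) tvec set" where
  "tangent_space A p = {v.
     (\<forall>c. c \<notin> charts_at A p \<longrightarrow> v c = 0) \<and>
     (\<forall>c \<in> charts_at A p. \<forall>d \<in> charts_at A p.
        v d = frechet_derivative (snd d \<circ> chart_inv c) (at (snd c p)) (v c))}"

text \<open>The tangent vector at \<open>p\<close> with coordinates \<open>y\<close> in the chart \<open>c\<close>.\<close>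

definition tvec_of ::
    "('m, 'a::euclidean_space) chart set \<Rightarrow> ('m, 'a) chart \<Rightarrow> 'm \<Rightarrow> 'a \<Rightarrow> ('m, 'a) tvec" where
  "tvec_of A c p y = (\<lambda>d. if d \<in> charts_at A p
     then frechet_derivative (snd d \<circ> chart_inv c) (at (snd c p)) y else 0)"

text \<open>
  Elements of \<open>TM\<close> are pairs of a base point and a tangent vector there, so the bundle
  projection is \<^const>\<open>fst\<close>.
\<close>

definition slit_tangent_bundle ::
    "('m, 'a::euclidean_space) chart set \<Rightarrow> ('m \<times> ('m, 'a) tvec) set" where
  "slit_tangent_bundle A = (SIGMA p:UNIV. tangent_space A p - {\<lambda>_. 0})"

text \<open>
  The differential \<open>df\<^sub>p(w)\<close>, computed in some chart around \<open>p\<close>; for smooth \<open>f\<close> and tangent \<open>w\<close>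
  it does not depend on the chart.
\<close>

definition differential ::
    "('m, 'a::euclidean_space) chart set \<Rightarrow> ('m \<Rightarrow> real) \<Rightarrow> 'm \<Rightarrow> ('m, 'a) tvec \<Rightarrow> real" where
  "differential A f p w = (let c = (SOME c. c \<in> charts_at A p)
     in frechet_derivative (f \<circ> chart_inv c) (at (snd c p)) (w c))"


section \<open>Finslerian metrics\<close>

definition fundamental_tensor ::
    "('m \<times> ('m, 'a::euclidean_space) tvec \<Rightarrow> real) \<Rightarrow> 'm \<times> ('m, 'a) tvec \<Rightarrow>
     ('m, 'a) tvec \<Rightarrow> ('m, 'a) tvec \<Rightarrow> real" where
  "fundamental_tensor L \<xi> u w = 1/2 *
     deriv (\<lambda>t. deriv (\<lambda>s. L (fst \<xi>, \<lambda>c. snd \<xi> c + t *\<^sub>R u c + s *\<^sub>R w c)) 0) 0"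

text \<open>
  \<open>L\<close> is a total function, but only its values on the slit tangent bundle matter. Its smoothness
  there is expressed in the bundle charts induced by the charts of \<open>M\<close>.
\<close>

definition finsler_metric ::
    "('m, 'a::euclidean_space) chart set \<Rightarrow> ('m \<times> ('m, 'a) tvec \<Rightarrow> real) \<Rightarrow> bool" where
  "finsler_metric A L \<longleftrightarrow>
     (\<forall>c\<in>A. smooth_on ((snd c ` fst c) \<times> (UNIV - {0}))
        (\<lambda>(x, y). L (chart_inv c x, tvec_of A c (chart_inv c x) y))) \<and>
     (\<forall>(p, v) \<in> slit_tangent_bundle A. \<forall>r>0. L (p, \<lambda>c. r *\<^sub>R v c) = r\<^sup>2 * L (p, v)) \<and>
     (\<forall>(p, v) \<in> slit_tangent_bundle A. \<forall>u \<in> tangent_space A p - {\<lambda>_. 0}.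
        fundamental_tensor L (p, v) u u > 0)"

definition gradient ::
    "('m, 'a::euclidean_space) chart set \<Rightarrow> ('m \<times> ('m, 'a) tvec \<Rightarrow> real) \<Rightarrow> ('m \<Rightarrow> real) \<Rightarrow>
     'm \<times> ('m, 'a) tvec \<Rightarrow> ('m, 'a) tvec" where
  "gradient A L f \<xi> = (THE u. u \<in> tangent_space A (fst \<xi>) \<and>
     (\<forall>w \<in> tangent_space A (fst \<xi>).
        fundamental_tensor L \<xi> u w = differential A f (fst \<xi>) w))"

text \<open>The Finsler norm \<open>F = \<surd>L\<close>, extended by \<open>0\<close> to zero vectors.\<close>

definition finsler_norm ::
    "('m \<times> ('m, 'a::euclidean_space) tvec \<Rightarrow> real) \<Rightarrow> 'm \<times> ('m, 'a) tvec \<Rightarrow> real" where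
  "finsler_norm L \<xi> = (if snd \<xi> = (\<lambda>_. 0) then 0 else sqrt (L \<xi>))"


section \<open>The Finslerian distance and completeness\<close>

text \<open>Smoothness on a closed interval means having a smooth extension to a neighbourhood of it.\<close>

definition smooth_curve_on ::
    "('m::topological_space, 'a::euclidean_space) chart set \<Rightarrow> real set \<Rightarrow> (real \<Rightarrow> 'm) \<Rightarrow> bool" where
  "smooth_curve_on A I \<gamma> \<longleftrightarrow> (\<exists>J \<delta>. open J \<and> I \<subseteq> J \<and> (\<forall>t\<in>I. \<delta> t = \<gamma> t) \<and>
     continuous_on J \<delta> \<and> (\<forall>c\<in>A. smooth_on {t\<in>J. \<delta> t \<in> fst c} (snd c \<circ> \<delta>)))"

definition piecewise_smooth_curve ::
    "('m::topological_space, 'a::euclidean_space) chart set \<Rightarrow> real \<Rightarrow> real \<Rightarrow> (real \<Rightarrow> 'm) \<Rightarrow> bool" where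
  "piecewise_smooth_curve A a b \<gamma> \<longleftrightarrow> a < b \<and>
     (\<exists>(n::nat) \<tau>. \<tau> 0 = a \<and> \<tau> n = b \<and>
        (\<forall>i<n. \<tau> i < \<tau> (Suc i) \<and> smooth_curve_on A {\<tau> i..\<tau> (Suc i)} \<gamma>))"

text \<open>At the finitely many breakpoints of a piecewise smooth curve the value is irrelevant.\<close>

definition velocity ::
    "('m, 'a::euclidean_space) chart set \<Rightarrow> (real \<Rightarrow> 'm) \<Rightarrow> real \<Rightarrow> ('m, 'a) tvec" where
  "velocity A \<gamma> t = (\<lambda>c. if c \<in> charts_at A (\<gamma> t)
     then vector_derivative (snd c \<circ> \<gamma>) (at t) else 0)"

definition curve_length ::
    "('m, 'a::euclidean_space) chart set \<Rightarrow> ('m \<times> ('m, 'a) tvec \<Rightarrow> real) \<Rightarrow>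
     real \<Rightarrow> real \<Rightarrow> (real \<Rightarrow> 'm) \<Rightarrow> real" where
  "curve_length A L a b \<gamma> = integral {a..b} (\<lambda>t. finsler_norm L (\<gamma> t, velocity A \<gamma> t))"

text \<open>The distance is \<open>\<infinity>\<close> between different connected components.\<close>

definition finsler_dist ::
    "('m::topological_space, 'a::euclidean_space) chart set \<Rightarrow>
     ('m \<times> ('m, 'a) tvec \<Rightarrow> real) \<Rightarrow> 'm \<Rightarrow> 'm \<Rightarrow> ereal" where
  "finsler_dist A L p q = Inf {ereal (curve_length A L a b \<gamma>) | a b \<gamma>.
     piecewise_smooth_curve A a b \<gamma> \<and> \<gamma> a = p \<and> \<gamma> b = q}"

definition forward_Cauchy ::
    "('m::topological_space, 'a::euclidean_space) chart set \<Rightarrow>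
     ('m \<times> ('m, 'a) tvec \<Rightarrow> real) \<Rightarrow> (nat \<Rightarrow> 'm) \<Rightarrow> bool" where
  "forward_Cauchy A L x \<longleftrightarrow>
     (\<forall>\<epsilon>::real. \<epsilon> > 0 \<longrightarrow> (\<exists>N. \<forall>m\<ge>N. \<forall>n\<ge>m. finsler_dist A L (x m) (x n) < ereal \<epsilon>))"

definition backward_Cauchy ::
    "('m::topological_space, 'a::euclidean_space) chart set \<Rightarrow>
     ('m \<times> ('m, 'a) tvec \<Rightarrow> real) \<Rightarrow> (nat \<Rightarrow> 'm) \<Rightarrow> bool" where
  "backward_Cauchy A L x \<longleftrightarrow>
     (\<forall>\<epsilon>::real. \<epsilon> > 0 \<longrightarrow> (\<exists>N. \<forall>m\<ge>N. \<forall>n\<ge>m. finsler_dist A L (x n) (x m) < ereal \<epsilon>))"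

text \<open>
  Convergence is meant in the topology of \<open>M\<close>, which is the one induced by the forward balls as
  well as by the backward balls of the distance.
\<close>

definition finsler_complete ::
    "('m::topological_space, 'a::euclidean_space) chart set \<Rightarrow>
     ('m \<times> ('m, 'a) tvec \<Rightarrow> real) \<Rightarrow> bool" where
  "finsler_complete A L \<longleftrightarrow>
     (\<forall>x. forward_Cauchy A L x \<longrightarrow> convergent x) \<and>
     (\<forall>x. backward_Cauchy A L x \<longrightarrow> convergent x)"

definition jacobi_metric ::
    "('m \<Rightarrow> real) \<Rightarrow> ('m \<times> ('m, 'a) tvec \<Rightarrow> real) \<Rightarrow> 'm \<times> ('m, 'a) tvec \<Rightarrow> real" where
  "jacobi_metric \<Phi> L = (\<lambda>\<xi>. (\<Phi> \<circ> fst) \<xi> * L \<xi>)"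

definition proper_function :: "('m::topological_space \<Rightarrow> real) \<Rightarrow> bool" where
  "proper_function f \<longleftrightarrow> (\<forall>K. compact K \<longrightarrow> compact (f -` K))"

end

theory Submission
  imports Defs
begin

text \<open>
  By the Cauchy--Schwarz inequality for \<open>g\<^sub>v\<close>, the hypothesis gives
  \<open>\<bar>df(v)\<bar> = \<bar>g\<^sub>v(\<nabla>\<^sup>vf, v)\<bar> \<le> sqrt (\<Phi> L(v))\<close>, so \<open>f\<close> is 1-Lipschitz for the Jacobi distance. Hence \<open>f\<close> is
  bounded along a forward or backward Cauchy sequence, which therefore stays in a compact set and
  has a convergent subsequence. To see that the whole sequence converges to the same point \<open>p\<close>,
  apply the same Lipschitz argument to \<open>C\<^sup>1\<close> bump functions \<open>h\<close> at \<open>p\<close>: \<open>h\<close> along the sequence is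
  Cauchy and subconverges to \<open>h(p) > 0\<close>, so the sequence eventually lies in the support of \<open>h\<close>.

  The symmetry of \<open>g\<^sub>v\<close> is not needed in full: by Euler's identity \<open>g\<^sub>v(u, v) = g\<^sub>v(v, u) = dL\<^sub>v(u) / 2\<close>,
  and this case suffices for the inequality above.
\<close>

section \<open>Derivatives and homogeneous functions\<close>

lemma smooth_on_differentiable:
  assumes "smooth_on S f" "x \<in> S"
  shows "f differentiable (at x)"
proof -
  have "C_k_on (Suc 0) f S" using assms(1) unfolding smooth_on_def by blast
  then show ?thesis using assms(2) by simp
qed

lemma smooth_on_continuous_on: "smooth_on S f \<Longrightarrow> continuous_on S f"
  unfolding smooth_on_def by (metis C_k_on.simps(1))

lemma smooth_on_frechet_derivative:
  assumes "smooth_on S f"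
  shows "smooth_on S (\<lambda>x. frechet_derivative f (at x) v)"
  unfolding smooth_on_def
proof
  fix k
  have "C_k_on (Suc k) f S" using assms unfolding smooth_on_def by blast
  then show "C_k_on k (\<lambda>x. frechet_derivative f (at x) v) S" by simp
qed

lemma has_derivative_frechet:
  "f differentiable (at x) \<Longrightarrow> (f has_derivative frechet_derivative f (at x)) (at x)"
  by (simp add: frechet_derivative_works)

lemma frechet_derivative_line:
  fixes g :: "'a::real_normed_vector \<Rightarrow> real"
  assumes "g differentiable (at z)"
  shows "((\<lambda>s. g (z + s *\<^sub>R w)) has_real_derivative frechet_derivative g (at z) w) (at 0)"
proof -
  have g: "(g has_derivative frechet_derivative g (at z)) (at (z + 0 *\<^sub>R w))"
    using has_derivative_frechet[OF assms] by simp
  have "((\<lambda>s. z + s *\<^sub>R w) has_derivative (\<lambda>s. s *\<^sub>R w)) (at 0)"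
    by (auto intro!: derivative_eq_intros)
  from has_derivative_compose[OF this g]
  have "((\<lambda>s. g (z + s *\<^sub>R w)) has_derivative (\<lambda>s. frechet_derivative g (at z) (s *\<^sub>R w))) (at 0)" .
  moreover have "(\<lambda>s. frechet_derivative g (at z) (s *\<^sub>R w)) = (*) (frechet_derivative g (at z) w)"
    using linear_scale[OF linear_frechet_derivative[OF assms]] by (simp add: fun_eq_iff mult.commute)
  ultimately show ?thesis by (simp add: has_field_derivative_def)
qed

lemma eventually_line_nonzero:
  fixes y :: "'a::real_normed_vector"
  assumes "y \<noteq> 0"
  shows "\<forall>\<^sub>F t in nhds (0::real). y + t *\<^sub>R u \<noteq> 0"
proof -
  have "isCont (\<lambda>t::real. y + t *\<^sub>R u) 0" by (intro continuous_intros)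
  then show ?thesis
    using assms tendsto_imp_eventually_ne[of "\<lambda>t. y + t *\<^sub>R u" y "at 0" 0]
    by (auto simp: eventually_nhds_conv_at isCont_def)
qed

text \<open>Euler's identity: on the ray through z the function is (1 + s)^k * g z, and the
  derivative of this at s = 0 is k * g z. It is applied with k = 2 to L on a fibre and with k = 1 to
  its directional derivatives.\<close>

lemma frechet_derivative_radial:
  fixes g :: "'a::real_normed_vector \<Rightarrow> real"
  assumes "g differentiable (at z)" and "\<And>r. r > 0 \<Longrightarrow> g (r *\<^sub>R z) = r ^ k * g z"
  shows "frechet_derivative g (at z) z = of_nat k * g z"
proof -
  \<comment> \<open>The factor 1 + s must be positive, because homogeneity is assumed for positive
    scalars only.\<close>
  have ev: "\<forall>\<^sub>F s in nhds (0::real). s > -1"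
    using eventually_nhds_in_open[of "{-1<..}" "0::real"] by simp
  have "((\<lambda>s. g (z + s *\<^sub>R z)) has_real_derivative frechet_derivative g (at z) z) (at 0)"
    by (rule frechet_derivative_line[OF assms(1)])
  moreover have "((\<lambda>s. g (z + s *\<^sub>R z)) has_real_derivative of_nat k * g z) (at 0)"
  proof (subst DERIV_cong_ev[OF refl _ refl])
    show "\<forall>\<^sub>F s in nhds 0. g (z + s *\<^sub>R z) = (1 + s) ^ k * g z"
      using ev
    proof eventually_elim
      case (elim s)
      have "z + s *\<^sub>R z = (1 + s) *\<^sub>R z" by (simp add: scaleR_add_left)
      then show ?case using assms(2)[of "1 + s"] elim by simp
    qed
    show "((\<lambda>s. (1 + s) ^ k * g z) has_real_derivative of_nat k * g z) (at 0)"
      by (auto intro!: derivative_eq_intros)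
  qed
  ultimately show ?thesis by (rule DERIV_unique)
qed

section \<open>Functions homogeneous of degree two on one vector space, and their fundamental
  tensor\<close>

locale homogeneous_quadratic =
  fixes l :: "'a::real_normed_vector \<Rightarrow> real"
  assumes diff1: "z \<noteq> 0 \<Longrightarrow> l differentiable (at z)"
    and diff2: "z \<noteq> 0 \<Longrightarrow> (\<lambda>x. frechet_derivative l (at x) w) differentiable (at z)"
    and homogeneous: "z \<noteq> 0 \<Longrightarrow> r > 0 \<Longrightarrow> l (r *\<^sub>R z) = r\<^sup>2 * l z"
begin

text \<open>\<open>l\<close> stands for L on a single tangent space written in the coordinates of a
  chart, and \<open>tensor\<close> is \<open>fundamental_tensor\<close> in these coordinates; see
  \<open>fundamental_tensor_fibre\<close>.\<close>

definition tensor :: "'a \<Rightarrow> 'a \<Rightarrow> 'a \<Rightarrow> real" where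
  "tensor y u w = 1/2 * deriv (\<lambda>t. deriv (\<lambda>s. l (y + t *\<^sub>R u + s *\<^sub>R w)) 0) 0"

abbreviation "dl z w \<equiv> frechet_derivative l (at z) w"

text \<open>The inner derivative equals \<open>dl (y + t *\<^sub>R u) w\<close> as long as
  \<open>y + t *\<^sub>R u\<close> avoids the origin, where \<open>l\<close> is uncontrolled. This
  holds for t near 0, which is enough for the outer derivative.\<close>

lemma tensor_eq:
  assumes "y \<noteq> 0"
  shows "tensor y u w = 1/2 * frechet_derivative (\<lambda>x. dl x w) (at y) u"
proof -
  have ev: "\<forall>\<^sub>F t in nhds 0. deriv (\<lambda>s. l (y + t *\<^sub>R u + s *\<^sub>R w)) 0 = dl (y + t *\<^sub>R u) w"
    using eventually_line_nonzero[OF assms, of u]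
    by eventually_elim (intro DERIV_imp_deriv frechet_derivative_line diff1)
  have "((\<lambda>t. dl (y + t *\<^sub>R u) w) has_real_derivative frechet_derivative (\<lambda>x. dl x w) (at y) u) (at 0)"
    by (rule frechet_derivative_line[OF diff2[OF assms]])
  then have "((\<lambda>t. deriv (\<lambda>s. l (y + t *\<^sub>R u + s *\<^sub>R w)) 0) has_real_derivative
      frechet_derivative (\<lambda>x. dl x w) (at y) u) (at 0)"
    by (subst DERIV_cong_ev[OF refl ev refl])
  then show ?thesis by (simp add: tensor_def DERIV_imp_deriv)
qed

lemma linear_tensor_left: "y \<noteq> 0 \<Longrightarrow> linear (\<lambda>u. tensor y u w)"
  using linear_compose_scale_right[OF linear_frechet_derivative[OF diff2], of y "1/2" w]
  by (simp add: tensor_eq)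

text \<open>The derivative \<open>dl z\<close> is linear at every nonzero z. Differentiating the
  identities that express this with respect to z, at z = y, makes the second derivative linear in
  its other argument.\<close>

lemma linear_tensor_right:
  assumes "y \<noteq> 0"
  shows "linear (tensor y u)"
proof (rule linearI)
  have lin: "linear (dl z)" if "z \<noteq> 0" for z
    using linear_frechet_derivative[OF diff1[OF that]] .
  have op: "open (UNIV - {0::'a})" by (simp add: open_delete)
  have D: "((\<lambda>x. dl x w) has_derivative frechet_derivative (\<lambda>x. dl x w) (at y)) (at y)" for w
    by (rule has_derivative_frechet[OF diff2[OF assms]])
  fix v w
  have "((\<lambda>x. dl x (v + w)) has_derivative
     (\<lambda>u. frechet_derivative (\<lambda>x. dl x v) (at y) u + frechet_derivative (\<lambda>x. dl x w) (at y) u)) (at y)"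
    by (rule has_derivative_transform_within_open[OF has_derivative_add[OF D[of v] D[of w]] op])
       (use assms lin in \<open>auto simp: linear_add\<close>)
  from frechet_derivative_at[OF this, symmetric] show "tensor y u (v + w) = tensor y u v + tensor y u w"
    using assms by (simp add: tensor_eq algebra_simps)
  fix r
  have "((\<lambda>x. dl x (r *\<^sub>R w)) has_derivative
     (\<lambda>u. r *\<^sub>R frechet_derivative (\<lambda>x. dl x w) (at y) u)) (at y)"
    by (rule has_derivative_transform_within_open[OF has_derivative_scaleR_right[OF D[of w]] op])
       (use assms lin in \<open>auto simp: linear_scale\<close>)
  from frechet_derivative_at[OF this, symmetric] show "tensor y u (r *\<^sub>R w) = r *\<^sub>R tensor y u w"
    using assms by (simp add: tensor_eq algebra_simps)
qed

lemma euler: "y \<noteq> 0 \<Longrightarrow> dl y y = 2 * l y"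
  using frechet_derivative_radial[of l y 2] diff1 homogeneous by simp

text \<open>Differentiate \<open>l (r *\<^sub>R x) = r\<^sup>2 * l x\<close> in x and cancel one
  factor r.\<close>

lemma dl_homogeneous:
  assumes "y \<noteq> 0" "r > 0"
  shows "dl (r *\<^sub>R y) w = r * dl y w"
proof -
  have ry: "r *\<^sub>R y \<noteq> 0" using assms by simp
  have op: "open (UNIV - {0::'a})" by (simp add: open_delete)
  have "((\<lambda>x. r *\<^sub>R x) has_derivative (\<lambda>x. r *\<^sub>R x)) (at y)" by (auto intro!: derivative_eq_intros)
  from has_derivative_compose[OF this has_derivative_frechet[OF diff1[OF ry]]]
  have "((\<lambda>x. l (r *\<^sub>R x)) has_derivative (\<lambda>x. dl (r *\<^sub>R y) (r *\<^sub>R x))) (at y)" .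
  then have "((\<lambda>x. r\<^sup>2 * l x) has_derivative (\<lambda>x. dl (r *\<^sub>R y) (r *\<^sub>R x))) (at y)"
    by (rule has_derivative_transform_within_open[OF _ op]) (use assms homogeneous in auto)
  moreover have "((\<lambda>x. r\<^sup>2 * l x) has_derivative (\<lambda>x. r\<^sup>2 * dl y x)) (at y)"
    using has_derivative_frechet[OF diff1[OF assms(1)]] by (auto intro!: derivative_eq_intros)
  ultimately have "dl (r *\<^sub>R y) (r *\<^sub>R w) = r\<^sup>2 * dl y w"
    using has_derivative_unique by metis
  then show ?thesis
    using assms linear_scale[OF linear_frechet_derivative[OF diff1[OF ry]], of r w]
    by (simp add: power2_eq_square)
qed

lemma tensor_radial_left: "y \<noteq> 0 \<Longrightarrow> tensor y y w = dl y w / 2"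
  using frechet_derivative_radial[of "\<lambda>x. dl x w" y 1] diff2 dl_homogeneous by (simp add: tensor_eq)

text \<open>Differentiate Euler's identity \<open>dl x x = 2 * l x\<close> along the line \<open>x = y + t *\<^sub>R u\<close>.\<close>

lemma tensor_radial_right:
  assumes "y \<noteq> 0"
  shows "tensor y u y = dl y u / 2"
proof -
  have ev: "\<forall>\<^sub>F t in nhds 0. dl (y + t *\<^sub>R u) y = 2 * l (y + t *\<^sub>R u) - t * dl (y + t *\<^sub>R u) u"
    using eventually_line_nonzero[OF assms, of u]
  proof eventually_elim
    case (elim t)
    note lin = linear_frechet_derivative[OF diff1[OF elim]]
    show ?case using euler[OF elim] linear_add[OF lin, of y "t *\<^sub>R u"] linear_scale[OF lin, of t u]
      by simp
  qed
  have "((\<lambda>t. dl (y + t *\<^sub>R u) y) has_real_derivative frechet_derivative (\<lambda>x. dl x y) (at y) u) (at 0)"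
    by (rule frechet_derivative_line[OF diff2[OF assms]])
  then have 1: "((\<lambda>t. 2 * l (y + t *\<^sub>R u) - t * dl (y + t *\<^sub>R u) u) has_real_derivative
      frechet_derivative (\<lambda>x. dl x y) (at y) u) (at 0)"
    by (subst (asm) DERIV_cong_ev[OF refl ev refl])
  have "((\<lambda>t. 2 * l (y + t *\<^sub>R u) - t * dl (y + t *\<^sub>R u) u) has_real_derivative
      2 * dl y u - dl y u) (at 0)"
    using frechet_derivative_line[OF diff1[OF assms], of u]
      frechet_derivative_line[OF diff2[OF assms], of u u]
    by (auto intro!: derivative_eq_intros)
  from DERIV_unique[OF 1 this] show ?thesis using assms by (simp add: tensor_eq)
qed

lemma tensor_self: "y \<noteq> 0 \<Longrightarrow> tensor y y y = l y"
  by (simp add: tensor_radial_left euler)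

text \<open>The form is nonnegative on the component of u orthogonal to y. Its mixed terms
  \<open>tensor y u y\<close> and \<open>tensor y y u\<close> agree because both equal
  \<open>dl y u / 2\<close>.\<close>

lemma tensor_Cauchy_Schwarz:
  assumes "y \<noteq> 0" and pos: "\<And>u. u \<noteq> 0 \<Longrightarrow> tensor y u u > 0"
  shows "(tensor y u y)\<^sup>2 \<le> tensor y u u * l y"
proof -
  note lin1 = linear_tensor_left[OF assms(1)] and lin2 = linear_tensor_right[OF assms(1)]
  have ly: "l y > 0" using pos[of y] assms tensor_self by simp
  define b where "b = tensor y u y"
  have b: "tensor y y u = b"
    using assms by (simp add: b_def tensor_radial_left tensor_radial_right)
  \<comment> \<open>The coefficient of the projection of u onto y, since
    \<open>tensor y y y = l y\<close>. It makes the last term \<open>b - c * l y\<close> in the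
    expansion below vanish.\<close>
  define c where "c = b / l y"
  have "0 \<le> tensor y (u - c *\<^sub>R y) (u - c *\<^sub>R y)"
    using pos[of "u - c *\<^sub>R y"] linear_0[OF lin1] by (cases "u - c *\<^sub>R y = 0") auto
  also have "\<dots> = tensor y u u - c * b - c * (b - c * l y)"
    by (simp add: linear_diff[OF lin1] linear_diff[OF lin2] linear_scale[OF lin1]
        linear_scale[OF lin2] b tensor_self assms flip: b_def)
  also have "\<dots> = tensor y u u - b\<^sup>2 / l y"
    using ly by (simp add: c_def power2_eq_square)
  finally show ?thesis using ly by (simp add: b_def divide_le_eq)
qed

end

text \<open>Existence and uniqueness together are what the definite description in
  \<open>gradient\<close> requires. The map \<open>T\<close> represents B through the inner product.
  Positivity makes it injective, hence surjective in finite dimension.\<close>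

lemma Riesz_positive_definite:
  fixes B :: "'a::euclidean_space \<Rightarrow> 'a \<Rightarrow> real"
  assumes lin1: "\<And>w. linear (\<lambda>u. B u w)" and lin2: "\<And>u. linear (B u)"
    and pos: "\<And>u. u \<noteq> 0 \<Longrightarrow> B u u > 0" and g: "linear g"
  shows "\<exists>!u. \<forall>w. B u w = g w"
proof -
  define T where "T u = (\<Sum>b\<in>Basis. B u b *\<^sub>R b)" for u
  have T_inner: "T u \<bullet> b = B u b" if "b \<in> Basis" for u b
    unfolding T_def using that by (simp add: inner_sum_left inner_Basis if_distrib cong: if_cong)
  have agree: "B u w = h w" if "linear h" "\<And>b. b \<in> Basis \<Longrightarrow> B u b = h b" for u w h
    using linear_eq_stdbasis[OF lin2 that(1), of u] that(2) by (auto simp: fun_eq_iff)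
  have lin_T: "linear T"
    by (rule linearI) (simp_all add: T_def linear_add[OF lin1] linear_scale[OF lin1]
        scaleR_add_left sum.distrib scaleR_sum_right)
  have zero: "u = 0" if "\<And>w. B u w = 0" for u using that[of u] pos[of u] by force
  have "inj T"
    unfolding linear_injective_0[OF lin_T]
  proof (intro allI impI)
    fix u assume "T u = 0"
    then have "B u b = 0" if "b \<in> Basis" for b using T_inner[OF that, of u] by simp
    then show "u = 0" using agree[of "\<lambda>_. 0" u] zero by (simp add: linear_zero)
  qed
  with lin_T have "surj T" by (simp add: linear_inj_imp_surj)
  then obtain u where u: "T u = (\<Sum>b\<in>Basis. g b *\<^sub>R b)" by (metis surjD)
  have "B u b = g b" if "b \<in> Basis" for b
    using T_inner[OF that, of u] that unfolding u
    by (simp add: inner_sum_left inner_Basis if_distrib cong: if_cong)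
  then have ex: "\<forall>w. B u w = g w" using agree[OF g] by blast
  show ?thesis
  proof (rule ex1I)
    show "\<forall>w. B u w = g w" by (rule ex)
  next
    fix v assume v: "\<forall>w. B v w = g w"
    have "B (v - u) w = 0" for w using v ex linear_diff[OF lin1] by simp
    then show "v = u" using zero[of "v - u"] by simp
  qed
qed

section \<open>Charts and tangent vectors\<close>

locale smooth_manifold =
  fixes A :: "('m::{t2_space,second_countable_topology}, 'a::euclidean_space) chart set"
  assumes atlas: "smooth_atlas A"
begin

lemma charts_atD: "c \<in> charts_at A p \<Longrightarrow> c \<in> A" "c \<in> charts_at A p \<Longrightarrow> p \<in> fst c"
  by (simp_all add: charts_at_def)

lemma charts_at_ex: "\<exists>c. c \<in> charts_at A p"
  using atlas unfolding smooth_atlas_def charts_at_def by blast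

lemma chart_homeomorphism:
  "c \<in> A \<Longrightarrow> homeomorphism (fst c) (snd c ` fst c) (snd c) (chart_inv c)"
  using atlas unfolding smooth_atlas_def is_chart_def by blast

lemma open_chart_domain: "c \<in> A \<Longrightarrow> open (fst c)"
  using atlas unfolding smooth_atlas_def is_chart_def by blast

lemma open_chart_image: "c \<in> A \<Longrightarrow> open (snd c ` fst c)"
  using atlas unfolding smooth_atlas_def is_chart_def by blast

lemma chart_inv_chart: "c \<in> A \<Longrightarrow> p \<in> fst c \<Longrightarrow> chart_inv c (snd c p) = p"
  by (rule homeomorphism_apply1[OF chart_homeomorphism])

lemma chart_chart_inv: "c \<in> A \<Longrightarrow> x \<in> snd c ` fst c \<Longrightarrow> snd c (chart_inv c x) = x"
  by (rule homeomorphism_apply2[OF chart_homeomorphism])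

lemma chart_inv_in: "c \<in> A \<Longrightarrow> x \<in> snd c ` fst c \<Longrightarrow> chart_inv c x \<in> fst c"
  by (auto simp: chart_inv_chart)

lemma open_chart_Int:
  assumes "c \<in> A" "open U"
  shows "open (snd c ` (fst c \<inter> U))"
proof -
  have "openin (top_of_set (snd c ` fst c)) (snd c ` (fst c \<inter> U))"
    by (rule homeomorphism_imp_open_map[OF chart_homeomorphism[OF assms(1)]])
       (use assms in \<open>auto simp: openin_open\<close>)
  then show ?thesis using open_chart_image[OF assms(1)] openin_open_eq by blast
qed

lemma transition_differentiable:
  assumes "c \<in> charts_at A p" "d \<in> charts_at A p"
  shows "(snd d \<circ> chart_inv c) differentiable (at (snd c p))"
proof (rule smooth_on_differentiable)
  show "smooth_on (snd c ` (fst c \<inter> fst d)) (snd d \<circ> chart_inv c)"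
    using atlas assms charts_atD unfolding smooth_atlas_def by blast
  show "snd c p \<in> snd c ` (fst c \<inter> fst d)" using assms charts_atD by blast
qed

text \<open>On the overlap of the two charts the left-hand function factors through the transition
  map, so this is the chain rule. With a chart map as \<psi> it is the cocycle identity behind
  \<open>tvec_of_in_tangent_space\<close>.\<close>

lemma chart_change:
  assumes "c \<in> charts_at A p" "d \<in> charts_at A p"
    and "(\<psi> \<circ> chart_inv d) differentiable (at (snd d p))"
  shows "((\<psi> \<circ> chart_inv c) has_derivative
    (\<lambda>y. frechet_derivative (\<psi> \<circ> chart_inv d) (at (snd d p))
      (frechet_derivative (snd d \<circ> chart_inv c) (at (snd c p)) y))) (at (snd c p))"
proof -
  note cd = charts_atD[OF assms(1)] charts_atD[OF assms(2)]
  have "((\<psi> \<circ> chart_inv d) has_derivative frechet_derivative (\<psi> \<circ> chart_inv d) (at (snd d p)))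
      (at ((snd d \<circ> chart_inv c) (snd c p)))"
    using has_derivative_frechet[OF assms(3)] cd by (simp add: chart_inv_chart)
  from has_derivative_compose[OF has_derivative_frechet[OF transition_differentiable[OF assms(1,2)]] this]
  show ?thesis
    by (rule has_derivative_transform_within_open[OF _ open_chart_Int[OF cd(1) open_chart_domain[OF cd(3)]]])
       (use cd in \<open>auto simp: chart_inv_chart\<close>)
qed

section \<open>Tangent vectors in the coordinates of a chart\<close>

lemma tvec_of_self:
  assumes "c \<in> charts_at A p"
  shows "tvec_of A c p y c = y"
proof -
  note cA = charts_atD[OF assms]
  have "((\<lambda>x. x) has_derivative (\<lambda>x. x)) (at (snd c p))" by (rule has_derivative_ident)
  then have "((snd c \<circ> chart_inv c) has_derivative (\<lambda>x. x)) (at (snd c p))"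
    by (rule has_derivative_transform_within_open[OF _ open_chart_image[OF cA(1)]])
       (use cA in \<open>auto simp: chart_inv_chart simp del: split_paired_All\<close>)
  from frechet_derivative_at[OF this, symmetric] show ?thesis
    using assms by (simp add: tvec_of_def)
qed

lemma tvec_of_in_tangent_space:
  assumes "c \<in> charts_at A p"
  shows "tvec_of A c p y \<in> tangent_space A p"
  unfolding tangent_space_def
proof (intro CollectI conjI allI impI ballI)
  fix d assume "d \<notin> charts_at A p"
  then show "tvec_of A c p y d = 0" by (simp add: tvec_of_def)
next
  fix d d' assume d: "d \<in> charts_at A p" "d' \<in> charts_at A p"
  show "tvec_of A c p y d' = frechet_derivative (snd d' \<circ> chart_inv d) (at (snd d p)) (tvec_of A c p y d)"
    using frechet_derivative_at[OF chart_change[OF assms d(1) transition_differentiable[OF d]], symmetric] d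
    by (simp add: tvec_of_def)
qed

text \<open>With \<open>tvec_of_self\<close> and \<open>tvec_of_in_tangent_space\<close>, this
  identifies the tangent space at p with the model space: y goes to \<open>tvec_of A c p y\<close>,
  and the inverse reads off the entry at c.\<close>

lemma tvec_of_component:
  assumes "c \<in> charts_at A p" "v \<in> tangent_space A p"
  shows "tvec_of A c p (v c) = v"
proof
  fix d
  show "tvec_of A c p (v c) d = v d"
  proof (cases "d \<in> charts_at A p")
    case True
    have "frechet_derivative (snd d \<circ> chart_inv c) (at (snd c p)) (v c) = v d"
      using assms(2)[unfolded tangent_space_def, THEN CollectD, THEN conjunct2, rule_format, OF assms(1) True]
      by (rule sym)
    then show ?thesis using True by (simp only: tvec_of_def if_True)
  next
    case False
    then have "v d = 0" using assms(2) unfolding tangent_space_def by blast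
    then show ?thesis using False by (simp only: tvec_of_def if_False)
  qed
qed

lemma tvec_of_add:
  assumes "c \<in> charts_at A p"
  shows "tvec_of A c p (y + z) = (\<lambda>d. tvec_of A c p y d + tvec_of A c p z d)"
  using linear_add[OF linear_frechet_derivative[OF transition_differentiable[OF assms]]]
  by (auto simp: tvec_of_def fun_eq_iff)

lemma tvec_of_scaleR:
  assumes "c \<in> charts_at A p"
  shows "tvec_of A c p (r *\<^sub>R y) = (\<lambda>d. r *\<^sub>R tvec_of A c p y d)"
  using linear_scale[OF linear_frechet_derivative[OF transition_differentiable[OF assms]]]
  by (auto simp: tvec_of_def fun_eq_iff)

lemma tvec_of_eq_0_iff:
  assumes "c \<in> charts_at A p"
  shows "tvec_of A c p y = (\<lambda>_. 0) \<longleftrightarrow> y = 0"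
proof
  assume "tvec_of A c p y = (\<lambda>_. 0)"
  then show "y = 0" using tvec_of_self[OF assms, of y] by simp
next
  assume "y = 0"
  then show "tvec_of A c p y = (\<lambda>_. 0)" using tvec_of_scaleR[OF assms, of 0 y] by simp
qed

lemma tvec_of_in_slit_iff:
  "c \<in> charts_at A p \<Longrightarrow> (p, tvec_of A c p y) \<in> slit_tangent_bundle A \<longleftrightarrow> y \<noteq> 0"
  using tvec_of_in_tangent_space tvec_of_eq_0_iff by (auto simp: slit_tangent_bundle_def)

text \<open>The target of \<psi> is left general for two uses: a second chart map, which gives the
  transformation law of the velocity, and a real function differentiated along the curve.\<close>

lemma curve_chain_rule:
  assumes "c \<in> charts_at A (\<delta> t)" and ev: "\<forall>\<^sub>F s in nhds t. \<delta> s \<in> fst c"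
    and "((snd c \<circ> \<delta>) has_vector_derivative y) (at t)"
    and "(\<psi> \<circ> chart_inv c) differentiable (at (snd c (\<delta> t)))"
  shows "((\<psi> \<circ> \<delta>) has_vector_derivative
      frechet_derivative (\<psi> \<circ> chart_inv c) (at (snd c (\<delta> t))) y) (at t)"
proof -
  note c = charts_atD[OF assms(1)]
  obtain U where U: "open U" "t \<in> U" "\<And>s. s \<in> U \<Longrightarrow> \<delta> s \<in> fst c"
    using ev unfolding eventually_nhds by blast
  have "((\<psi> \<circ> chart_inv c) has_derivative frechet_derivative (\<psi> \<circ> chart_inv c) (at (snd c (\<delta> t))))
      (at ((snd c \<circ> \<delta>) t))"
    using has_derivative_frechet[OF assms(4)] by simp
  from vector_derivative_diff_chain_within[OF assms(3) has_derivative_at_withinI[OF this]]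
  show ?thesis
    by (rule has_vector_derivative_transform_within_open[OF _ U(1,2)])
       (use U c in \<open>auto simp: chart_inv_chart\<close>)
qed

lemma velocity_eq_tvec_of:
  assumes "c \<in> charts_at A (\<delta> t)" and "\<forall>\<^sub>F s in nhds t. \<delta> s \<in> fst c"
    and "((snd c \<circ> \<delta>) has_vector_derivative y) (at t)"
  shows "velocity A \<delta> t = tvec_of A c (\<delta> t) y"
proof
  fix d
  show "velocity A \<delta> t d = tvec_of A c (\<delta> t) y d"
  proof (cases "d \<in> charts_at A (\<delta> t)")
    case True
    from curve_chain_rule[OF assms transition_differentiable[OF assms(1) True]]
    show ?thesis using True by (simp add: velocity_def tvec_of_def vector_derivative_at)
  qed (simp add: velocity_def tvec_of_def)
qed

text \<open>The velocity depends only on the germ of the curve. Inside an interval a curve may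
  therefore be replaced by the smooth extension supplied by \<open>smooth_curve_on\<close>.\<close>

lemma velocity_cong:
  assumes "\<forall>\<^sub>F s in nhds t. \<gamma> s = \<delta> s"
  shows "velocity A \<gamma> t = velocity A \<delta> t"
proof -
  have "vector_derivative (snd c \<circ> \<gamma>) (at t) = vector_derivative (snd c \<circ> \<delta>) (at t)"
    for c :: "('m, 'a) chart"
    using assms by (intro vector_derivative_cong_eq) (auto elim: eventually_mono)
  moreover have "\<gamma> t = \<delta> t" using eventually_nhds_x_imp_x[OF assms] .
  ultimately show ?thesis by (simp only: velocity_def)
qed

end

section \<open>Functions with differential bounded by the norm\<close>

text \<open>Squaring the positive part removes its corner: at 0 the difference quotient is
  \<open>max 0 h\<close>, which tends to 0. This yields a bump function with an explicit
  derivative.\<close>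

lemma DERIV_max_0_power2: "((\<lambda>s. (max 0 s)\<^sup>2) has_real_derivative 2 * max 0 x) (at x)"
proof (rule linorder_cases[of x 0])
  assume "x < 0"
  have "((\<lambda>s. 0) has_real_derivative 0) (at x)" by simp
  then have "((\<lambda>s. (max 0 s)\<^sup>2) has_real_derivative 0) (at x)"
    by (rule has_field_derivative_transform_within_open[of _ _ _ "{..<0}"]) (use \<open>x < 0\<close> in auto)
  then show ?thesis using \<open>x < 0\<close> by simp
next
  assume "x > 0"
  have "((\<lambda>s. s\<^sup>2) has_real_derivative 2 * x) (at x)" by (auto intro!: derivative_eq_intros)
  then have "((\<lambda>s. (max 0 s)\<^sup>2) has_real_derivative 2 * x) (at x)"
    by (rule has_field_derivative_transform_within_open[of _ _ _ "{0<..}"]) (use \<open>x > 0\<close> in auto)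
  then show ?thesis using \<open>x > 0\<close> by simp
next
  assume "x = 0"
  have "((\<lambda>h::real. max 0 h) \<longlongrightarrow> 0) (at 0)"
    using tendsto_max[OF tendsto_const tendsto_ident_at, of "0::real" 0 UNIV] by simp
  then have "((\<lambda>h::real. (max 0 h)\<^sup>2 / h) \<longlongrightarrow> 0) (at 0)"
    by (rule Lim_transform_eventually)
      (auto simp: eventually_at_filter power2_eq_square max_def)
  then show ?thesis using \<open>x = 0\<close> by (simp add: DERIV_def)
qed

lemma frechet_vector_derivative:
  assumes "\<delta> differentiable (at t)"
  shows "(\<delta> has_vector_derivative frechet_derivative \<delta> (at t) 1) (at t)"
proof -
  have "frechet_derivative \<delta> (at t) s = s *\<^sub>R frechet_derivative \<delta> (at t) 1" for s
    using linear_scale[OF linear_frechet_derivative[OF assms], of s 1] by (simp only: real_scaleR_def mult_1_right)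
  then have "frechet_derivative \<delta> (at t) = (\<lambda>s. s *\<^sub>R frechet_derivative \<delta> (at t) 1)"
    by (rule ext)
  then show ?thesis using has_derivative_frechet[OF assms] unfolding has_vector_derivative_def by metis
qed

text \<open>Collects the properties of a metric on which the length and distance arguments rest. The
  Jacobi metric is shown to have them in \<open>continuous_finsler_jacobi\<close>.\<close>

locale continuous_finsler = smooth_manifold A
  for A :: "('m::{t2_space,second_countable_topology}, 'a::euclidean_space) chart set" +
  fixes L :: "'m \<times> ('m, 'a) tvec \<Rightarrow> real"
  assumes cont: "c \<in> A \<Longrightarrow> continuous_on ((snd c ` fst c) \<times> (UNIV - {0}))
        (\<lambda>(x, y). L (chart_inv c x, tvec_of A c (chart_inv c x) y))"
    and hom: "(p, v) \<in> slit_tangent_bundle A \<Longrightarrow> r > 0 \<Longrightarrow> L (p, \<lambda>c. r *\<^sub>R v c) = r\<^sup>2 * L (p, v)"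
    and pos: "\<xi> \<in> slit_tangent_bundle A \<Longrightarrow> L \<xi> > 0"
begin

abbreviation "F \<equiv> finsler_norm L"

definition chart_norm :: "('m, 'a) chart \<Rightarrow> 'a \<Rightarrow> 'a \<Rightarrow> real" where
  "chart_norm c x y = F (chart_inv c x, tvec_of A c (chart_inv c x) y)"

lemma F_tvec_of:
  "c \<in> charts_at A p \<Longrightarrow> F (p, tvec_of A c p y) = (if y = 0 then 0 else sqrt (L (p, tvec_of A c p y)))"
  by (simp add: finsler_norm_def tvec_of_eq_0_iff)

lemma F_nonneg: "c \<in> charts_at A p \<Longrightarrow> F (p, tvec_of A c p y) \<ge> 0"
  using pos tvec_of_in_slit_iff by (auto simp: F_tvec_of less_imp_le)

lemma chart_at_chart_inv: "c \<in> A \<Longrightarrow> x \<in> snd c ` fst c \<Longrightarrow> c \<in> charts_at A (chart_inv c x)"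
  by (simp add: charts_at_def chart_inv_in)

lemma chart_norm_pos:
  assumes "c \<in> A" "x \<in> snd c ` fst c" "y \<noteq> 0"
  shows "chart_norm c x y > 0"
  using pos tvec_of_in_slit_iff chart_at_chart_inv[OF assms(1,2)] assms(3)
  by (simp add: chart_norm_def F_tvec_of)

lemma chart_norm_0: "c \<in> A \<Longrightarrow> x \<in> snd c ` fst c \<Longrightarrow> chart_norm c x 0 = 0"
  using chart_at_chart_inv by (simp add: chart_norm_def F_tvec_of)

lemma chart_norm_scaleR:
  assumes "c \<in> A" "x \<in> snd c ` fst c" "r \<ge> 0"
  shows "chart_norm c x (r *\<^sub>R y) = r * chart_norm c x y"
proof (cases "r = 0 \<or> y = 0")
  case True
  then show ?thesis using chart_norm_0[OF assms(1,2)] by auto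
next
  case False
  note c = chart_at_chart_inv[OF assms(1,2)]
  show ?thesis
    using False assms(3) tvec_of_in_slit_iff[OF c, of y] F_tvec_of[OF c, of y]
      F_tvec_of[OF c, of "r *\<^sub>R y"] hom[of "chart_inv c x" "tvec_of A c (chart_inv c x) y" r]
    by (simp add: chart_norm_def tvec_of_scaleR[OF c] real_sqrt_mult)
qed

lemma continuous_on_chart_norm_slit:
  assumes "c \<in> A"
  shows "continuous_on ((snd c ` fst c) \<times> (UNIV - {0})) (\<lambda>(x, y). chart_norm c x y)"
proof -
  have "continuous_on ((snd c ` fst c) \<times> (UNIV - {0}))
      (\<lambda>\<xi>. sqrt (case \<xi> of (x, y) \<Rightarrow> L (chart_inv c x, tvec_of A c (chart_inv c x) y)))"
    by (intro continuous_intros cont assms)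
  then show ?thesis
    by (rule continuous_on_eq)
       (auto simp: chart_norm_def F_tvec_of[OF chart_at_chart_inv[OF assms]] split: if_splits)
qed

text \<open>By homogeneity it suffices to bound the norm on the product of K with the unit sphere.
  There a continuous positive function attains a positive minimum and a finite maximum.\<close>

lemma chart_norm_bounds:
  assumes c: "c \<in> A" and K: "compact K" "K \<subseteq> snd c ` fst c"
  obtains m M where "m > 0"
    "\<And>x y. x \<in> K \<Longrightarrow> m * norm y \<le> chart_norm c x y"
    "\<And>x y. x \<in> K \<Longrightarrow> chart_norm c x y \<le> M * norm y"
proof (cases "K = {}")
  case True
  then show ?thesis using that[of 1] by simp
next
  case False
  let ?S = "K \<times> sphere (0::'a) 1" and ?N = "\<lambda>(x, y). chart_norm c x y"
  have "(SOME i. i \<in> Basis) \<in> sphere (0::'a) 1" by (simp add: SOME_Basis)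
  then have ne: "?S \<noteq> {}" using False by blast
  have S: "compact ?S" using K by (intro compact_Times) auto
  have cont: "continuous_on ?S ?N"
    by (rule continuous_on_subset[OF continuous_on_chart_norm_slit[OF c]]) (use K in auto)
  obtain \<xi> where \<xi>: "\<xi> \<in> ?S" "\<And>\<eta>. \<eta> \<in> ?S \<Longrightarrow> ?N \<xi> \<le> ?N \<eta>"
    using continuous_attains_inf[OF S ne cont] by blast
  obtain \<zeta> where \<zeta>: "\<zeta> \<in> ?S" "\<And>\<eta>. \<eta> \<in> ?S \<Longrightarrow> ?N \<eta> \<le> ?N \<zeta>"
    using continuous_attains_sup[OF S ne cont] by blast
  have bounds: "?N \<xi> * norm y \<le> chart_norm c x y \<and> chart_norm c x y \<le> ?N \<zeta> * norm y"
    if "x \<in> K" for x y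
  proof (cases "y = 0")
    case True
    then show ?thesis using that K c chart_norm_0 by (metis mult_zero_right norm_zero order_refl subsetD)
  next
    case False
    have mem: "(x, inverse (norm y) *\<^sub>R y) \<in> ?S" using that False by simp
    have "chart_norm c x (norm y *\<^sub>R (inverse (norm y) *\<^sub>R y))
        = norm y * chart_norm c x (inverse (norm y) *\<^sub>R y)"
      by (rule chart_norm_scaleR) (use that K c in auto)
    then have "chart_norm c x y = norm y * ?N (x, inverse (norm y) *\<^sub>R y)"
      using False by simp
    then show ?thesis
      using \<xi>(2)[OF mem] \<zeta>(2)[OF mem] by (simp add: mult.commute mult_left_mono)
  qed
  have "?N \<xi> > 0" using \<xi>(1) K(2) by (auto intro!: chart_norm_pos[OF c])
  then show ?thesis using that bounds by blast
qed

text \<open>Curves may have zero velocity, so continuity is also needed at zero vectors, where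
  smoothness of L says nothing. There it follows from the upper bound M * norm y, which is uniform
  over a closed ball of base points.\<close>

lemma continuous_on_chart_norm:
  assumes c: "c \<in> A"
  shows "continuous_on ((snd c ` fst c) \<times> UNIV) (\<lambda>(x, y). chart_norm c x y)" (is "continuous_on ?T ?N")
proof -
  have op: "open ((snd c ` fst c) \<times> (UNIV - {0::'a}))"
    by (intro open_Times open_chart_image c open_delete) auto
  have "isCont ?N (x, y)" if x: "x \<in> snd c ` fst c" for x y
  proof (cases "y = 0")
    case False
    then show ?thesis
      using continuous_on_chart_norm_slit[OF c] continuous_on_eq_continuous_at[OF op] x by blast
  next
    case True
    obtain r where r: "r > 0" "cball x r \<subseteq> snd c ` fst c"
      using open_contains_cball open_chart_image[OF c] x by metis
    obtain M where M: "\<And>z w. z \<in> cball x r \<Longrightarrow> chart_norm c z w \<le> M * norm w"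
      using chart_norm_bounds[OF c compact_cball r(2)] by metis
    have "open (ball x r \<times> (UNIV :: 'a set))" by (intro open_Times) auto
    then have "\<forall>\<^sub>F \<xi> in at (x, 0::'a). \<xi> \<in> ball x r \<times> UNIV"
      using r(1) by (intro eventually_at_in_open') auto
    then have "\<forall>\<^sub>F \<xi> in at (x, 0::'a). norm (?N \<xi>) \<le> M * norm (snd \<xi>)"
    proof eventually_elim
      case (elim \<xi>)
      then have fst: "fst \<xi> \<in> cball x r" by auto
      then have "chart_norm c (fst \<xi>) (snd \<xi>) \<ge> 0"
        using F_nonneg chart_at_chart_inv[OF c] r(2) unfolding chart_norm_def by blast
      then show ?case using M[OF fst] by (simp add: case_prod_beta)
    qed
    moreover have "((\<lambda>\<xi>. M * norm (snd \<xi>)) \<longlongrightarrow> M * norm (snd (x, 0::'a))) (at (x, 0::'a))"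
      by (intro tendsto_intros)
    ultimately have "(?N \<longlongrightarrow> 0) (at (x, 0))"
      using Lim_null_comparison[of ?N "\<lambda>\<xi>. M * norm (snd \<xi>)" "at (x, 0)"] by simp
    then show ?thesis using True chart_norm_0[OF c x] by (simp add: isCont_def)
  qed
  then show ?thesis by (auto intro!: continuous_at_imp_continuous_on)
qed

section \<open>Speed of curves, and Lipschitz bounds obtained by integrating along them\<close>

lemma eventually_in_chart:
  assumes "open J" "continuous_on J \<delta>" "t \<in> J" "open U" "\<delta> t \<in> U"
  shows "\<forall>\<^sub>F s in nhds t. \<delta> s \<in> U"
proof -
  have "open (J \<inter> \<delta> -` U)" by (rule continuous_open_preimage[OF assms(2,1,4)])
  then have "\<forall>\<^sub>F s in nhds t. s \<in> J \<inter> \<delta> -` U"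
    using assms(3,5) by (intro eventually_nhds_in_open) auto
  then show ?thesis by eventually_elim simp
qed

text \<open>In a chart the speed is \<open>chart_norm\<close> composed with the coordinates of the
  curve and their derivative, and both of these are continuous. This makes the length integrand
  integrable.\<close>

lemma continuous_on_speed:
  assumes J: "open J" "continuous_on J \<delta>"
    and smooth: "\<And>c. c \<in> A \<Longrightarrow> smooth_on {t\<in>J. \<delta> t \<in> fst c} (snd c \<circ> \<delta>)"
  shows "continuous_on J (\<lambda>t. F (\<delta> t, velocity A \<delta> t))"
proof (rule continuous_at_imp_continuous_on, rule ballI)
  fix t assume t: "t \<in> J"
  obtain c where c: "c \<in> charts_at A (\<delta> t)" using charts_at_ex by blast
  note cA = charts_atD[OF c]
  define V where "V = {t\<in>J. \<delta> t \<in> fst c}"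
  have V_eq: "V = J \<inter> \<delta> -` fst c" by (auto simp: V_def)
  have V: "open V"
    unfolding V_eq by (rule continuous_open_preimage[OF J(2,1) open_chart_domain[OF cA(1)]])
  note sm = smooth[OF cA(1), folded V_def]
  let ?y = "\<lambda>t. frechet_derivative (snd c \<circ> \<delta>) (at t) 1"
  have "continuous_on V (\<lambda>t. ((snd c \<circ> \<delta>) t, ?y t))"
    by (intro continuous_on_Pair smooth_on_continuous_on sm smooth_on_frechet_derivative)
  then have "continuous_on V ((\<lambda>(x, y). chart_norm c x y) \<circ> (\<lambda>t. ((snd c \<circ> \<delta>) t, ?y t)))"
    by (intro continuous_on_compose continuous_on_subset[OF continuous_on_chart_norm[OF cA(1)]])
       (auto simp: V_def)
  then have "continuous_on V (\<lambda>t. F (\<delta> t, velocity A \<delta> t))"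
  proof (rule continuous_on_eq)
    fix s assume s: "s \<in> V"
    have "((snd c \<circ> \<delta>) has_vector_derivative ?y s) (at s)"
      by (rule frechet_vector_derivative[OF smooth_on_differentiable[OF sm s]])
    then have "velocity A \<delta> s = tvec_of A c (\<delta> s) (?y s)"
      using s V cA by (intro velocity_eq_tvec_of eventually_in_chart[OF J] open_chart_domain)
        (auto simp: V_def charts_at_def)
    then show "((\<lambda>(x, y). chart_norm c x y) \<circ> (\<lambda>t. ((snd c \<circ> \<delta>) t, ?y t))) s = F (\<delta> s, velocity A \<delta> s)"
      using s cA by (simp add: chart_norm_def chart_inv_chart V_def)
  qed
  moreover have "t \<in> V" using t cA by (simp add: V_def)
  ultimately show "isCont (\<lambda>t. F (\<delta> t, velocity A \<delta> t)) t"
    using continuous_on_eq_continuous_at[OF V] by blast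
qed

text \<open>The bound |dh| \<le> C * F on tangent vectors. One chart per point is asked for, so that
  each point can be treated in a convenient chart; mere differentiability of h admits the bump
  functions built below.\<close>

definition dominated :: "real \<Rightarrow> ('m \<Rightarrow> real) \<Rightarrow> bool" where
  "dominated C h \<longleftrightarrow> (\<forall>p. \<exists>c\<in>charts_at A p. (h \<circ> chart_inv c) differentiable (at (snd c p)) \<and>
     (\<forall>y. \<bar>frechet_derivative (h \<circ> chart_inv c) (at (snd c p)) y\<bar> \<le> C * F (p, tvec_of A c p y)))"

lemma dominated_isCont:
  assumes "dominated C h"
  shows "isCont h p"
proof -
  obtain c where c: "c \<in> charts_at A p" and d: "(h \<circ> chart_inv c) differentiable (at (snd c p))"
    using assms unfolding dominated_def by blast
  note cA = charts_atD[OF c]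
  have "isCont (snd c) p"
    using homeomorphism_cont1[OF chart_homeomorphism[OF cA(1)]] open_chart_domain[OF cA(1)] cA(2)
      continuous_on_eq_continuous_at by blast
  then have "isCont ((h \<circ> chart_inv c) \<circ> snd c) p"
    using differentiable_imp_continuous_within[OF d] by (rule continuous_at_compose)
  moreover have "\<forall>\<^sub>F q in nhds p. ((h \<circ> chart_inv c) \<circ> snd c) q = h q"
    using eventually_nhds_in_open[OF open_chart_domain[OF cA(1)] cA(2)]
    by eventually_elim (simp add: chart_inv_chart cA)
  ultimately show ?thesis using isCont_cong by blast
qed

lemma dominated_smooth_curve:
  assumes dom: "dominated C h" and "a < b" and \<gamma>: "smooth_curve_on A {a..b} \<gamma>"
  shows "(\<lambda>t. F (\<gamma> t, velocity A \<gamma> t)) integrable_on {a..b}"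
    and "\<bar>h (\<gamma> b) - h (\<gamma> a)\<bar> \<le> C * curve_length A L a b \<gamma>"
proof -
  obtain J \<delta> where J: "open J" "{a..b} \<subseteq> J" "continuous_on J \<delta>"
    and eq: "\<And>t. t \<in> {a..b} \<Longrightarrow> \<delta> t = \<gamma> t"
    and smooth: "\<And>c. c \<in> A \<Longrightarrow> smooth_on {t\<in>J. \<delta> t \<in> fst c} (snd c \<circ> \<delta>)"
    using \<gamma> unfolding smooth_curve_on_def by blast
  let ?G = "\<lambda>t. F (\<gamma> t, velocity A \<gamma> t)" and ?D = "\<lambda>t. F (\<delta> t, velocity A \<delta> t)"
  have int: "?D integrable_on {a..b}"
    using continuous_on_speed[OF J(1,3) smooth] J(2)
    by (intro integrable_continuous_real) (rule continuous_on_subset)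
  \<comment> \<open>Only interior points are compared: at the endpoints the two-sided derivative of
    \<gamma> may differ from that of its extension \<delta>, but two points do not affect the
    integral.\<close>
  have spike: "?G t = ?D t" if "t \<in> {a..b} - {a, b}" for t
  proof -
    have "\<forall>\<^sub>F s in nhds t. s \<in> {a<..<b}" using that by (intro eventually_nhds_in_open) auto
    then have "\<forall>\<^sub>F s in nhds t. \<gamma> s = \<delta> s" by eventually_elim (simp add: eq)
    from velocity_cong[OF this] show ?thesis using that eq by simp
  qed
  then show "?G integrable_on {a..b}"
    using integrable_spike_finite[OF _ _ int, of "{a, b}" ?G] by auto
  have len: "curve_length A L a b \<gamma> = integral {a..b} ?D"
    unfolding curve_length_def
    by (rule integral_spike[of "{a, b}"]) (use spike in auto)
  have "\<exists>d. ((h \<circ> \<delta>) has_vector_derivative d) (at t) \<and> \<bar>d\<bar> \<le> C * ?D t" if t: "t \<in> {a..b}" for t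
  proof -
    obtain c where c: "c \<in> charts_at A (\<delta> t)"
      and hd: "(h \<circ> chart_inv c) differentiable (at (snd c (\<delta> t)))"
      and hb: "\<And>y. \<bar>frechet_derivative (h \<circ> chart_inv c) (at (snd c (\<delta> t))) y\<bar>
          \<le> C * F (\<delta> t, tvec_of A c (\<delta> t) y)"
      using dom unfolding dominated_def by blast
    note cA = charts_atD[OF c]
    have "(snd c \<circ> \<delta>) differentiable (at t)"
      using smooth_on_differentiable[OF smooth[OF cA(1)]] t J(2) cA(2) by blast
    then obtain y where y: "((snd c \<circ> \<delta>) has_vector_derivative y) (at t)"
      using vector_derivative_works by blast
    have ev: "\<forall>\<^sub>F s in nhds t. \<delta> s \<in> fst c"
      using t J cA by (intro eventually_in_chart[OF J(1,3)] open_chart_domain) auto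
    show ?thesis
      using curve_chain_rule[OF c ev y hd] velocity_eq_tvec_of[OF c ev y] hb[of y] by auto
  qed
  then obtain d where d: "\<And>t. t \<in> {a..b} \<Longrightarrow> ((h \<circ> \<delta>) has_vector_derivative d t) (at t)"
    and db: "\<And>t. t \<in> {a..b} \<Longrightarrow> \<bar>d t\<bar> \<le> C * ?D t" by metis
  \<comment> \<open>For the gauge integral the fundamental theorem also yields integrability of the
    derivative \<open>d\<close>, whose continuity is not known.\<close>
  have "(d has_integral ((h \<circ> \<delta>) b - (h \<circ> \<delta>) a)) {a..b}"
  proof (rule fundamental_theorem_of_calculus)
    show "a \<le> b" using \<open>a < b\<close> by simp
  qed (rule has_vector_derivative_at_within[OF d])
  moreover have "(h \<circ> \<delta>) b - (h \<circ> \<delta>) a = h (\<gamma> b) - h (\<gamma> a)"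
    using eq[of a] eq[of b] \<open>a < b\<close> by simp
  ultimately have FTC: "d integrable_on {a..b}" "integral {a..b} d = h (\<gamma> b) - h (\<gamma> a)"
    by (metis has_integral_integrable, metis integral_unique)
  have "norm (integral {a..b} d) \<le> integral {a..b} (\<lambda>t. C * ?D t)"
    using FTC(1) int db by (intro integral_norm_bound_integral integrable_on_mult_right) auto
  then show "\<bar>h (\<gamma> b) - h (\<gamma> a)\<bar> \<le> C * curve_length A L a b \<gamma>"
    by (simp add: FTC(2) len)
qed

lemma dominated_curve:
  assumes dom: "dominated C h" and \<gamma>: "piecewise_smooth_curve A a b \<gamma>"
  shows "\<bar>h (\<gamma> b) - h (\<gamma> a)\<bar> \<le> C * curve_length A L a b \<gamma>"
proof -
  let ?G = "\<lambda>t. F (\<gamma> t, velocity A \<gamma> t)"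
  obtain n :: nat and \<tau> where \<tau>: "\<tau> 0 = a" "\<tau> n = b"
    and step: "\<And>i. i < n \<Longrightarrow> \<tau> i < \<tau> (Suc i)" "\<And>i. i < n \<Longrightarrow> smooth_curve_on A {\<tau> i..\<tau> (Suc i)} \<gamma>"
    using \<gamma> unfolding piecewise_smooth_curve_def by blast
  \<comment> \<open>Integrability is carried through the induction because additivity of the
    integral over adjacent intervals requires it.\<close>
  have "i \<le> n \<Longrightarrow> \<tau> 0 \<le> \<tau> i \<and> ?G integrable_on {\<tau> 0..\<tau> i} \<and>
      \<bar>h (\<gamma> (\<tau> i)) - h (\<gamma> (\<tau> 0))\<bar> \<le> C * curve_length A L (\<tau> 0) (\<tau> i) \<gamma>" for i
  proof (induction i)
    case 0
    show ?case using integrable_on_refl[of ?G "\<tau> 0"] by (simp add: curve_length_def)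
  next
    case (Suc i)
    then have i: "i < n" and IH: "\<tau> 0 \<le> \<tau> i" "?G integrable_on {\<tau> 0..\<tau> i}"
      "\<bar>h (\<gamma> (\<tau> i)) - h (\<gamma> (\<tau> 0))\<bar> \<le> C * curve_length A L (\<tau> 0) (\<tau> i) \<gamma>" by auto
    note piece = dominated_smooth_curve[OF dom step(1)[OF i] step(2)[OF i]]
    have le: "\<tau> i \<le> \<tau> (Suc i)" using step(1)[OF i] by simp
    have int: "?G integrable_on {\<tau> 0..\<tau> (Suc i)}"
      by (rule Henstock_Kurzweil_Integration.integrable_combine[OF IH(1) le IH(2) piece(1)])
    have "curve_length A L (\<tau> 0) (\<tau> i) \<gamma> + curve_length A L (\<tau> i) (\<tau> (Suc i)) \<gamma>
        = curve_length A L (\<tau> 0) (\<tau> (Suc i)) \<gamma>"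
      unfolding curve_length_def by (rule Henstock_Kurzweil_Integration.integral_combine[OF IH(1) le int])
    then have "C * curve_length A L (\<tau> 0) (\<tau> i) \<gamma> + C * curve_length A L (\<tau> i) (\<tau> (Suc i)) \<gamma>
        = C * curve_length A L (\<tau> 0) (\<tau> (Suc i)) \<gamma>"
      by (simp flip: distrib_left)
    then show ?case using int IH piece(2) le by linarith
  qed
  from this[of n] \<tau> show ?thesis by simp
qed

text \<open>An infimum below \<epsilon> provides a curve of length below \<epsilon>. The absolute
  value is symmetric in p and q although the distance need not be, which lets
  \<open>dominated_Cauchy\<close> treat forward and backward sequences together.\<close>

lemma dominated_dist:
  assumes "dominated C h" "C > 0" "finsler_dist A L p q < ereal \<epsilon>"
  shows "\<bar>h q - h p\<bar> < C * \<epsilon>"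
proof -
  obtain a b \<gamma> where \<gamma>: "piecewise_smooth_curve A a b \<gamma>" "\<gamma> a = p" "\<gamma> b = q"
    and len: "curve_length A L a b \<gamma> < \<epsilon>"
    using assms(3) unfolding finsler_dist_def Inf_less_iff by auto
  have "\<bar>h q - h p\<bar> \<le> C * curve_length A L a b \<gamma>"
    using dominated_curve[OF assms(1) \<gamma>(1)] \<gamma> by simp
  also have "\<dots> < C * \<epsilon>" using len assms(2) by simp
  finally show ?thesis .
qed

lemma dominated_Cauchy:
  assumes dom: "dominated C h" "C > 0" and x: "forward_Cauchy A L x \<or> backward_Cauchy A L x"
  shows "Cauchy (\<lambda>n. h (x n))"
proof (rule CauchyI')
  fix \<epsilon> :: real assume "\<epsilon> > 0"
  then have "\<epsilon> / C > 0" using dom by simp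
  then obtain N where N: "\<And>m n. m \<ge> N \<Longrightarrow> n \<ge> m \<Longrightarrow>
      finsler_dist A L (x m) (x n) < ereal (\<epsilon> / C) \<or> finsler_dist A L (x n) (x m) < ereal (\<epsilon> / C)"
    using x unfolding forward_Cauchy_def backward_Cauchy_def by metis
  have "dist (h (x m)) (h (x n)) < \<epsilon>" if "m \<ge> N" "n > m" for m n
    using N[of m n] that dominated_dist[OF dom, of "x m" "x n" "\<epsilon> / C"]
      dominated_dist[OF dom, of "x n" "x m" "\<epsilon> / C"] dom(2)
    by (auto simp: dist_real_def abs_minus_commute)
  then show "\<exists>N. \<forall>m\<ge>N. \<forall>n>m. dist (h (x m)) (h (x n)) < \<epsilon>" by blast
qed

text \<open>In a chart, h is the squared positive part of r^2 - |x - x0|^2, extended by 0. On the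
  compact coordinate ball the Finsler norm is at least m times the Euclidean one, so it controls
  dh.\<close>

lemma dominated_bump:
  assumes U: "open U" "p0 \<in> U"
  obtains h C where "dominated C h" "C > 0" "h p0 > 0" "\<And>p. p \<notin> U \<Longrightarrow> h p = 0"
proof -
  obtain c where c: "c \<in> charts_at A p0" using charts_at_ex by blast
  note cA = charts_atD[OF c]
  define x0 where "x0 = snd c p0"
  have "x0 \<in> snd c ` (fst c \<inter> U)" using cA U by (auto simp: x0_def)
  then obtain r where r: "r > 0" "cball x0 r \<subseteq> snd c ` (fst c \<inter> U)"
    using open_contains_cball open_chart_Int[OF cA(1) U(1)] by metis
  then have sub: "cball x0 r \<subseteq> snd c ` fst c" by blast
  obtain m where m: "m > 0" "\<And>x y. x \<in> cball x0 r \<Longrightarrow> m * norm y \<le> chart_norm c x y"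
    using chart_norm_bounds[OF cA(1) compact_cball sub] by metis
  define g where "g y = (max 0 (r\<^sup>2 - (y - x0) \<bullet> (y - x0)))\<^sup>2" for y
  define h where "h p = (if p \<in> fst c then g (snd c p) else 0)" for p
  \<comment> \<open>The derivative of \<open>g\<close> at a point of the ball is at most 4 * r^2 * r
    * norm w in absolute value; division by m converts norm w to the Finsler norm.\<close>
  define C where "C = 4 * r\<^sup>2 * r / m"
  have C: "C > 0" using r m by (simp add: C_def)
  have g_zero: "g y = 0" if "y \<notin> cball x0 r" for y
  proof -
    have "r\<^sup>2 \<le> (norm (y - x0))\<^sup>2" using that r(1) by (intro power_mono) (auto simp: dist_norm norm_minus_commute)
    then show ?thesis by (simp add: g_def dot_square_norm)
  qed
  define Q where "Q = chart_inv c ` cball x0 r"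
  have "compact Q" unfolding Q_def
    using homeomorphism_cont2[OF chart_homeomorphism[OF cA(1)]] sub
    by (intro compact_continuous_image) (auto intro: continuous_on_subset)
  \<comment> \<open>Since M is Hausdorff, the compact set \<open>Q\<close> is closed in all of M,
    not only in the chart domain. Thus h vanishes near every point outside \<open>Q\<close>,
    including points on the boundary of the chart domain.\<close>
  then have Q: "open (- Q)" by (simp add: compact_imp_closed open_Compl)
  have h_zero: "h p = 0" if "p \<notin> Q" for p
  proof (cases "p \<in> fst c")
    case True
    then have "snd c p \<notin> cball x0 r"
      using that chart_inv_chart[OF cA(1) True] unfolding Q_def by (metis imageI)
    then show ?thesis by (simp add: h_def g_zero)
  qed (simp add: h_def)
  have "\<exists>d\<in>charts_at A p. (h \<circ> chart_inv d) differentiable (at (snd d p)) \<and>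
     (\<forall>y. \<bar>frechet_derivative (h \<circ> chart_inv d) (at (snd d p)) y\<bar> \<le> C * F (p, tvec_of A d p y))" for p
  \<comment> \<open>On \<open>Q\<close>, boundary sphere included, the explicit formula in chart c
    applies. Off \<open>Q\<close> the function is locally zero and any chart will do.\<close>
  proof (cases "p \<in> Q")
    case True
    then obtain z where z: "z \<in> cball x0 r" "p = chart_inv c z" by (auto simp: Q_def)
    have zc: "z \<in> snd c ` fst c" using z sub by blast
    have cp: "c \<in> charts_at A p" using chart_at_chart_inv[OF cA(1) zc] z by simp
    have cpz: "snd c p = z" using chart_chart_inv[OF cA(1) zc] z by simp
    let ?D = "\<lambda>w. - (4 * max 0 (r\<^sup>2 - (z - x0) \<bullet> (z - x0)) * ((z - x0) \<bullet> w))"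
    have "((\<lambda>y. r\<^sup>2 - (y - x0) \<bullet> (y - x0)) has_derivative (\<lambda>w. - (2 * ((z - x0) \<bullet> w)))) (at z)"
      by (auto intro!: derivative_eq_intros simp: inner_commute)
    from has_derivative_compose[OF this DERIV_max_0_power2[unfolded has_field_derivative_def]]
    have "(g has_derivative ?D) (at z)"
      unfolding g_def by (simp add: mult_ac)
    then have D: "((h \<circ> chart_inv c) has_derivative ?D) (at z)"
      by (rule has_derivative_transform_within_open[OF _ open_chart_image[OF cA(1)] zc])
         (simp add: h_def chart_inv_in chart_chart_inv cA)
    have "\<bar>?D w\<bar> \<le> C * F (p, tvec_of A c p w)" for w
    proof -
      have "norm (z - x0) \<le> r" using z by (simp add: dist_norm norm_minus_commute)
      then have "\<bar>(z - x0) \<bullet> w\<bar> \<le> r * norm w"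
        using Cauchy_Schwarz_ineq2[of "z - x0" w] by (meson mult_right_mono norm_ge_zero order_trans)
      moreover have "max 0 (r\<^sup>2 - (z - x0) \<bullet> (z - x0)) \<le> r\<^sup>2" by simp
      ultimately have "4 * max 0 (r\<^sup>2 - (z - x0) \<bullet> (z - x0)) * \<bar>(z - x0) \<bullet> w\<bar> \<le> 4 * r\<^sup>2 * (r * norm w)"
        by (intro mult_mono) auto
      also have "\<dots> = C * (m * norm w)" using m(1) by (simp add: C_def)
      also have "\<dots> \<le> C * chart_norm c z w" using C m(2)[OF z(1)] by simp
      finally show ?thesis using z by (simp add: chart_norm_def abs_mult)
    qed
    then show ?thesis
      using D cp cpz frechet_derivative_at[OF D, symmetric]
      by (intro bexI[of _ c]) (auto simp: differentiable_def)
  next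
    case False
    obtain d where d: "d \<in> charts_at A p" using charts_at_ex by blast
    note dA = charts_atD[OF d]
    have "((\<lambda>_. 0) has_derivative (\<lambda>_. 0)) (at (snd d p))" by simp
    then have D: "((h \<circ> chart_inv d) has_derivative (\<lambda>_. 0)) (at (snd d p))"
      by (rule has_derivative_transform_within_open[OF _ open_chart_Int[OF dA(1) Q]])
         (use False dA in \<open>auto simp: chart_inv_chart h_zero\<close>)
    then show ?thesis
      using d frechet_derivative_at[OF D, symmetric] C F_nonneg[OF d]
      by (intro bexI[of _ d]) (auto simp: differentiable_def)
  qed
  then have "dominated C h" by (simp add: dominated_def)
  moreover have "h p0 > 0" using cA r by (simp add: h_def g_def x0_def)
  moreover have "h p = 0" if "p \<notin> U" for p
  proof (rule h_zero)
    show "p \<notin> Q" using that r(2) cA(1) by (auto simp: Q_def subset_iff chart_inv_chart)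
  qed
  ultimately show ?thesis using that C by blast
qed

text \<open>Bump functions link the distance to the topology of M: the values of h along the whole
  sequence converge to \<open>h p > 0\<close>, and positivity of h forces membership in U.\<close>

lemma Cauchy_subseq_tendsto:
  assumes x: "forward_Cauchy A L x \<or> backward_Cauchy A L x"
    and k: "strict_mono (k :: nat \<Rightarrow> nat)" "(x \<circ> k) \<longlonglongrightarrow> p"
  shows "x \<longlonglongrightarrow> p"
proof (rule topological_tendstoI)
  fix U assume "open U" "p \<in> U"
  then obtain h C where h: "dominated C h" "C > 0" "h p > 0" "\<And>q. q \<notin> U \<Longrightarrow> h q = 0"
    using dominated_bump by metis
  have "(\<lambda>n. h ((x \<circ> k) n)) \<longlonglongrightarrow> h p"
    using isCont_tendsto_compose[OF dominated_isCont[OF h(1)] k(2)] .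
  moreover obtain l where l: "(\<lambda>n. h (x n)) \<longlonglongrightarrow> l"
    using dominated_Cauchy[OF h(1,2) x] Cauchy_convergent convergentD by blast
  moreover from LIMSEQ_subseq_LIMSEQ[OF l k(1)] have "(\<lambda>n. h ((x \<circ> k) n)) \<longlonglongrightarrow> l"
    by (simp add: o_def)
  ultimately have "(\<lambda>n. h (x n)) \<longlonglongrightarrow> h p" using LIMSEQ_unique by blast
  then have "\<forall>\<^sub>F n in sequentially. h (x n) > 0" using h(3) order_tendstoD(1) by blast
  then show "\<forall>\<^sub>F n in sequentially. x n \<in> U" by eventually_elim (use h(4) in force)
qed

lemma complete_if_proper_dominated:
  assumes f: "dominated C f" "C > 0" "proper_function f"
  shows "finsler_complete A L"
proof -
  have "convergent x" if x: "forward_Cauchy A L x \<or> backward_Cauchy A L x" for x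
  proof -
    obtain R where R: "\<And>n. norm (f (x n)) \<le> R"
      using Cauchy_Bseq[OF dominated_Cauchy[OF f(1,2) x]] unfolding Bseq_def by blast
    \<comment> \<open>Properness turns the bound on f along the sequence into compactness; second
      countability then permits passing to a convergent subsequence.\<close>
    have "compact (f -` cball 0 R)" using f(3) unfolding proper_function_def by auto
    moreover have "\<forall>n. x n \<in> f -` cball 0 R" using R by simp
    ultimately obtain p k where "strict_mono (k :: nat \<Rightarrow> nat)" "(x \<circ> k) \<longlonglongrightarrow> p"
      using compact_imp_seq_compact unfolding seq_compact_def by blast
    then show ?thesis using Cauchy_subseq_tendsto[OF x] convergent_def by blast
  qed
  then show ?thesis by (simp add: finsler_complete_def)
qed

end

section \<open>The fundamental tensor and the gradient\<close>

locale finsler_manifold = smooth_manifold A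
  for A :: "('m::{t2_space,second_countable_topology}, 'a::euclidean_space) chart set" +
  fixes L :: "'m \<times> ('m, 'a) tvec \<Rightarrow> real"
  assumes finsler: "finsler_metric A L"
begin

section \<open>Reduction of the fundamental tensor to a single fibre\<close>

lemma L_scaleR: "(p, v) \<in> slit_tangent_bundle A \<Longrightarrow> r > 0 \<Longrightarrow> L (p, \<lambda>c. r *\<^sub>R v c) = r\<^sup>2 * L (p, v)"
  using finsler unfolding finsler_metric_def by blast

lemma L_smooth: "c \<in> A \<Longrightarrow> smooth_on ((snd c ` fst c) \<times> (UNIV - {0}))
    (\<lambda>(x, y). L (chart_inv c x, tvec_of A c (chart_inv c x) y))"
  using finsler unfolding finsler_metric_def by blast

lemma fundamental_tensor_pos:
  assumes "c \<in> charts_at A p" "y \<noteq> 0" "u \<noteq> 0"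
  shows "fundamental_tensor L (p, tvec_of A c p y) (tvec_of A c p u) (tvec_of A c p u) > 0"
proof -
  have "tvec_of A c p u \<in> tangent_space A p - {\<lambda>_. 0}"
    using assms tvec_of_in_tangent_space tvec_of_eq_0_iff by simp
  moreover have "(p, tvec_of A c p y) \<in> slit_tangent_bundle A"
    using assms tvec_of_in_slit_iff by simp
  ultimately show ?thesis using finsler unfolding finsler_metric_def by blast
qed

text \<open>The fibre over p is embedded by \<open>j\<close> into the domain of the coordinate
  expression \<open>G\<close> of L, so fibre derivatives are derivatives of \<open>G\<close> in the
  directions (0, w). The auxiliary fact \<open>comp\<close> is used for \<open>G\<close> and again
  for its directional derivatives.\<close>

lemma homogeneous_quadratic_fibre:
  assumes c: "c \<in> charts_at A p"
  shows "homogeneous_quadratic (\<lambda>y. L (p, tvec_of A c p y))"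
proof -
  note cA = charts_atD[OF c]
  let ?T = "(snd c ` fst c) \<times> (UNIV - {0::'a})"
  let ?l = "\<lambda>y. L (p, tvec_of A c p y)"
  define G where "G = (\<lambda>(x, y). L (chart_inv c x, tvec_of A c (chart_inv c x) y))"
  note sm = L_smooth[OF cA(1), folded G_def]
  define j where "j y = (snd c p, y)" for y :: 'a
  have jT: "j y \<in> ?T" if "y \<noteq> 0" for y using that cA by (auto simp: j_def)
  have dj: "(j has_derivative (\<lambda>w. (0, w))) (at y)" for y
    unfolding j_def by (auto intro!: derivative_eq_intros)
  have l: "?l = G \<circ> j" using cA by (simp add: G_def j_def o_def chart_inv_chart)
  have op: "open (UNIV - {0::'a})" by (simp add: open_delete)
  have comp: "((H \<circ> j) has_derivative (\<lambda>w. frechet_derivative H (at (j y)) (0, w))) (at y)"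
    if "smooth_on ?T H" "y \<noteq> 0" for H :: "'a \<times> 'a \<Rightarrow> real" and y
    using has_derivative_compose[OF dj has_derivative_frechet[OF smooth_on_differentiable[OF that(1) jT[OF that(2)]]]]
    by (simp add: o_def)
  have dl: "frechet_derivative ?l (at y) w = frechet_derivative G (at (j y)) (0, w)" if "y \<noteq> 0" for y w
    using frechet_derivative_at[OF comp[OF sm that]] l by metis
  show ?thesis
  proof
    fix y :: 'a assume y: "y \<noteq> 0"
    show "?l differentiable (at y)"
      using comp[OF sm y] l unfolding differentiable_def by metis
    fix w
    have "((\<lambda>x. frechet_derivative G (at x) (0, w)) \<circ> j has_derivative
        (\<lambda>v. frechet_derivative (\<lambda>x. frechet_derivative G (at x) (0, w)) (at (j y)) (0, v))) (at y)"
      by (rule comp[OF smooth_on_frechet_derivative[OF sm] y])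
    then have "((\<lambda>x. frechet_derivative ?l (at x) w) has_derivative
        (\<lambda>v. frechet_derivative (\<lambda>x. frechet_derivative G (at x) (0, w)) (at (j y)) (0, v))) (at y)"
      by (rule has_derivative_transform_within_open[OF _ op]) (use y dl in auto)
    then show "(\<lambda>x. frechet_derivative ?l (at x) w) differentiable (at y)"
      unfolding differentiable_def by blast
  next
    fix y :: 'a and r :: real assume "y \<noteq> 0" "r > 0"
    then show "?l (r *\<^sub>R y) = r\<^sup>2 * ?l y"
      using L_scaleR[of p "tvec_of A c p y" r] tvec_of_in_slit_iff[OF c, of y] tvec_of_scaleR[OF c, of r y]
      by simp
  qed
qed

lemma fundamental_tensor_fibre:
  assumes c: "c \<in> charts_at A p"
  shows "fundamental_tensor L (p, tvec_of A c p y) (tvec_of A c p u) (tvec_of A c p w)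
    = homogeneous_quadratic.tensor (\<lambda>y. L (p, tvec_of A c p y)) y u w"
  unfolding homogeneous_quadratic.tensor_def[OF homogeneous_quadratic_fibre[OF c]] fundamental_tensor_def
  by (simp add: tvec_of_add[OF c] tvec_of_scaleR[OF c])

text \<open>Euler's identities give L(v) = g_v(v, v), so positivity of L follows from positive
  definiteness.\<close>

lemma L_pos:
  assumes "\<xi> \<in> slit_tangent_bundle A"
  shows "L \<xi> > 0"
proof -
  obtain p v where \<xi>: "\<xi> = (p, v)" by (cases \<xi>)
  obtain c where c: "c \<in> charts_at A p" using charts_at_ex by blast
  have v: "tvec_of A c p (v c) = v"
    using tvec_of_component[OF c] assms by (auto simp: \<xi> slit_tangent_bundle_def)
  then have "v c \<noteq> 0" using tvec_of_in_slit_iff[OF c, of "v c"] assms \<xi> by simp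
  then show ?thesis
    using fundamental_tensor_pos[OF c, of "v c" "v c"] v \<xi>
      homogeneous_quadratic.tensor_self[OF homogeneous_quadratic_fibre[OF c], of "v c"]
      fundamental_tensor_fibre[OF c, of "v c" "v c" "v c"]
    by simp
qed

text \<open>The coordinates u of the gradient represent df with respect to g_v, so df(v) = g_v(u,
  v), and the fibrewise inequality applies.\<close>

lemma gradient_Cauchy_Schwarz:
  assumes f: "smooth_function A f" and p: "(p, v) \<in> slit_tangent_bundle A"
  shows "(differential A f p v)\<^sup>2
    \<le> fundamental_tensor L (p, v) (gradient A L f (p, v)) (gradient A L f (p, v)) * L (p, v)"
proof -
  \<comment> \<open>The same choice of chart as in \<open>differential\<close>, which then unfolds
    directly in these coordinates.\<close>
  define c where "c = (SOME c. c \<in> charts_at A p)"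
  have c: "c \<in> charts_at A p" unfolding c_def using charts_at_ex by (rule someI_ex)
  note cA = charts_atD[OF c]
  interpret l: homogeneous_quadratic "\<lambda>y. L (p, tvec_of A c p y)"
    by (rule homogeneous_quadratic_fibre[OF c])
  define y where "y = v c"
  have v: "tvec_of A c p y = v"
    using tvec_of_component[OF c] p by (auto simp: y_def slit_tangent_bundle_def)
  then have y: "y \<noteq> 0" using tvec_of_in_slit_iff[OF c, of y] p by simp
  note g = fundamental_tensor_fibre[OF c, of y, unfolded v]
  have pos: "l.tensor y u u > 0" if "u \<noteq> 0" for u
    using fundamental_tensor_pos[OF c y that] by (simp add: v g)
  let ?df = "frechet_derivative (f \<circ> chart_inv c) (at (snd c p))"
  have df: "differential A f p w = ?df (w c)" for w
    by (simp add: differential_def Let_def flip: c_def)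
  have "(f \<circ> chart_inv c) differentiable (at (snd c p))"
    using f cA by (intro smooth_on_differentiable[of "snd c ` fst c"]) (auto simp: smooth_function_def)
  then have "linear ?df" by (rule linear_frechet_derivative)
  then have "\<exists>!u. \<forall>w. l.tensor y u w = ?df w"
    using Riesz_positive_definite[OF l.linear_tensor_left[OF y] l.linear_tensor_right[OF y] pos] by blast
  then obtain u where u: "\<And>w. l.tensor y u w = ?df w"
    and unique: "\<And>u'. (\<And>w. l.tensor y u' w = ?df w) \<Longrightarrow> u' = u" by metis
  have "gradient A L f (p, v) = tvec_of A c p u"
    unfolding gradient_def fst_conv
  proof (rule the_equality)
    show "tvec_of A c p u \<in> tangent_space A p \<and>
        (\<forall>w\<in>tangent_space A p. fundamental_tensor L (p, v) (tvec_of A c p u) w = differential A f p w)"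
      using tvec_of_in_tangent_space[OF c] g u tvec_of_component[OF c] df by metis
  next
    fix u'
    assume u': "u' \<in> tangent_space A p \<and>
        (\<forall>w\<in>tangent_space A p. fundamental_tensor L (p, v) u' w = differential A f p w)"
    have "l.tensor y (u' c) w = ?df w" for w
      using u' g[of "u' c" w] tvec_of_component[OF c, of u'] tvec_of_in_tangent_space[OF c, of w]
        df[of "tvec_of A c p w"] tvec_of_self[OF c, of w] by metis
    then show "u' = tvec_of A c p u" using unique tvec_of_component[OF c, of u'] u' by metis
  qed
  then show ?thesis
    using l.tensor_Cauchy_Schwarz[OF y pos, of u] u[of y] g[of u u] df[of v] v by (simp add: y_def)
qed

section \<open>The Jacobi metric and the given proper function\<close>

lemma continuous_finsler_jacobi:
  assumes \<Phi>: "smooth_function A \<phi>" "\<Phi> = (\<lambda>p. e - \<phi> p)" "\<And>p. \<Phi> p > 0"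
  shows "continuous_finsler A (jacobi_metric \<Phi> L)"
proof
  fix c assume c: "c \<in> A"
  let ?T = "(snd c ` fst c) \<times> (UNIV - {0::'a})"
  have "continuous_on (snd c ` fst c) (\<phi> \<circ> chart_inv c)"
    using \<Phi>(1) c unfolding smooth_function_def by (blast intro: smooth_on_continuous_on)
  then have "continuous_on (snd c ` fst c) (\<lambda>x. \<Phi> (chart_inv c x))"
    unfolding \<Phi>(2) o_def by (intro continuous_intros)
  then have "continuous_on ?T (\<lambda>\<xi>. \<Phi> (chart_inv c (fst \<xi>)))"
    by (rule continuous_on_compose2) (auto intro!: continuous_intros)
  then have "continuous_on ?T (\<lambda>\<xi>. \<Phi> (chart_inv c (fst \<xi>)) *
      (case \<xi> of (x, y) \<Rightarrow> L (chart_inv c x, tvec_of A c (chart_inv c x) y)))"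
    by (rule continuous_on_mult[OF _ smooth_on_continuous_on[OF L_smooth[OF c]]])
  then show "continuous_on ?T (\<lambda>(x, y). jacobi_metric \<Phi> L (chart_inv c x, tvec_of A c (chart_inv c x) y))"
    by (simp add: jacobi_metric_def case_prod_beta)
next
  fix p v and r :: real assume "(p, v) \<in> slit_tangent_bundle A" "r > 0"
  then show "jacobi_metric \<Phi> L (p, \<lambda>c. r *\<^sub>R v c) = r\<^sup>2 * jacobi_metric \<Phi> L (p, v)"
    by (simp add: jacobi_metric_def L_scaleR)
next
  fix \<xi> assume "\<xi> \<in> slit_tangent_bundle A"
  then show "jacobi_metric \<Phi> L \<xi> > 0" using L_pos \<Phi>(3) by (simp add: jacobi_metric_def)
qed

text \<open>The constant is 1 because df(v)^2 \<le> g_v(grad f, grad f) * L(v) \<le> \<Phi> * L(v),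
  and the last expression is the Jacobi metric itself, the square of its norm.\<close>

lemma dominated_jacobi:
  assumes M: "continuous_finsler A (jacobi_metric \<Phi> L)" and f: "smooth_function A f"
    and grad: "\<And>\<xi>. \<xi> \<in> slit_tangent_bundle A \<Longrightarrow>
      fundamental_tensor L \<xi> (gradient A L f \<xi>) (gradient A L f \<xi>) \<le> \<Phi> (fst \<xi>)"
  shows "continuous_finsler.dominated A (jacobi_metric \<Phi> L) 1 f"
  unfolding continuous_finsler.dominated_def[OF M]
proof
  fix p
  define c where "c = (SOME c. c \<in> charts_at A p)"
  have c: "c \<in> charts_at A p" unfolding c_def using charts_at_ex by (rule someI_ex)
  note cA = charts_atD[OF c]
  let ?df = "frechet_derivative (f \<circ> chart_inv c) (at (snd c p))"
  have diff: "(f \<circ> chart_inv c) differentiable (at (snd c p))"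
    using f cA by (intro smooth_on_differentiable[of "snd c ` fst c"]) (auto simp: smooth_function_def)
  have "\<bar>?df y\<bar> \<le> 1 * finsler_norm (jacobi_metric \<Phi> L) (p, tvec_of A c p y)" for y
  \<comment> \<open>The gradient hypothesis speaks of nonzero vectors only; at the zero vector the
    left-hand side vanishes by linearity.\<close>
  proof (cases "y = 0")
    case True
    then show ?thesis
      using linear_0[OF linear_frechet_derivative[OF diff]] continuous_finsler.F_nonneg[OF M c] by simp
  next
    case False
    let ?v = "tvec_of A c p y"
    have v: "(p, ?v) \<in> slit_tangent_bundle A" using False tvec_of_in_slit_iff[OF c] by simp
    have "?df y = differential A f p ?v"
      using tvec_of_self[OF c] by (simp add: differential_def Let_def flip: c_def)
    then have "(?df y)\<^sup>2 \<le> \<Phi> p * L (p, ?v)"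
      using gradient_Cauchy_Schwarz[OF f v] mult_right_mono[OF grad[OF v] less_imp_le[OF L_pos[OF v]]]
      by simp
    then have "\<bar>?df y\<bar> \<le> sqrt (\<Phi> p * L (p, ?v))" by (rule real_le_rsqrt[of "\<bar>_\<bar>", simplified])
    then show ?thesis
      using continuous_finsler.F_tvec_of[OF M c, of y] False by (simp add: jacobi_metric_def)
  qed
  then show "\<exists>c\<in>charts_at A p. (f \<circ> chart_inv c) differentiable (at (snd c p)) \<and>
     (\<forall>y. \<bar>frechet_derivative (f \<circ> chart_inv c) (at (snd c p)) y\<bar>
       \<le> 1 * finsler_norm (jacobi_metric \<Phi> L) (p, tvec_of A c p y))"
    using c diff by blast
qed

end

theorem proposition4p11:
  fixes A :: "('m::{t2_space,second_countable_topology}, 'a::euclidean_space) chart set"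
    and L :: "'m \<times> ('m, 'a) tvec \<Rightarrow> real"
    and \<phi> \<Phi> :: "'m \<Rightarrow> real"
    and e :: real
  assumes "smooth_atlas A"
    and "finsler_metric A L"
    and "smooth_function A \<phi>"
    and "\<Phi> = (\<lambda>p. e - \<phi> p)"
    and "\<forall>p. \<Phi> p > 0"
    and "\<exists>f. smooth_function A f \<and> proper_function f \<and>
           (\<forall>\<xi> \<in> slit_tangent_bundle A.
              fundamental_tensor L \<xi> (gradient A L f \<xi>) (gradient A L f \<xi>) \<le> \<Phi> (fst \<xi>))"
  shows "finsler_complete A (jacobi_metric \<Phi> L)"
proof -
  interpret finsler_manifold A L by unfold_locales fact+
  interpret jacobi: continuous_finsler A "jacobi_metric \<Phi> L"
    using assms by (intro continuous_finsler_jacobi) auto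
  obtain f where f: "smooth_function A f" "proper_function f"
    "\<And>\<xi>. \<xi> \<in> slit_tangent_bundle A \<Longrightarrow>
      fundamental_tensor L \<xi> (gradient A L f \<xi>) (gradient A L f \<xi>) \<le> \<Phi> (fst \<xi>)"
    using assms(6) by blast
  show ?thesis
    using dominated_jacobi[OF jacobi.continuous_finsler_axioms f(1,3)] f(2)
    by (intro jacobi.complete_if_proper_dominated) auto
qed

end
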